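(* Let $\mathscr{S}$ be a numerical semigroup. Then $\operatorname{ULF}(\mathscr{S})=\operatorname{Ap}(\mathscr{S},\operatorname{UBetti}(\mathscr{S}))$.
   Context: A numerical semigroup is a submonoid $\mathscr{S}$ of $(\mathbb{N},+)$ with finite complement in $\mathbb{N}=\{0,1,2,\dots\}$; let $\{n_1,\dots,n_e\}$ be its minimal generating set. For $r\in\mathscr{S}$, $\operatorname{F}(r,\mathscr{S})=\{(a_1,\dots,a_e)\in\mathbb{N}^e:a_1n_1+\dots+a_en_e=r\}$ is the set of factorizations of $r$; the length of a factorization $z$ is $|z|=a_1+\dots+a_e$; $\operatorname{L}(r,\mathscr{S})=\{|z|:z\in\operatorname{F}(r,\mathscr{S})\}$; $\operatorname{ULF}(\mathscr{S})=\{r\in\mathscr{S}:\operatorname{L}(r,\mathscr{S})\text{ has exactly one element}\}$. For $r\in\mathscr{S}$, let $\nabla_r$ be the graph with vertex set $\operatorname{F}(r,\mathscr{S})$ in which two vertices are joined by an edge if their dot product is nonzero (they have common support); $r$ is a Betti element if $\nabla_r$ is not connected. $\operatorname{Betti}(\mathscr{S})$ is the set of Betti elements, $\operatorname{BBetti}(\mathscr{S})=\operatorname{Betti}(\mathscr{S})\cap\operatorname{ULF}(\mathscr{S})$ and $\operatorname{UBetti}(\mathscr{S})=\operatorname{Betti}(\mathscr{S})\setminus\operatorname{BBetti}(\mathscr{S})$. For $X\subseteq\mathscr{S}\setminus\{0\}$, $\operatorname{Ap}(\mathscr{S},X)=\mathscr{S}\setminus(X+\mathscr{S})=\{s\in\mathscr{S}:s-x\notin\mathscr{S}\text{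 for all }x\in X\}$; in particular $\operatorname{Ap}(\mathscr{S},\emptyset)=\mathscr{S}$. *)

theory Defs
  imports "HOL-Library.Set_Algebras" "Graph_Theory.Digraph_Component"
begin

definition submonoid_nat :: "nat set \<Rightarrow> bool" where
  "submonoid_nat S \<longleftrightarrow> 0 \<in> S \<and> (\<forall>x\<in>S. \<forall>y\<in>S. x + y \<in> S)"

definition numerical_semigroup :: "nat set \<Rightarrow> bool" where
  "numerical_semigroup S \<longleftrightarrow> submonoid_nat S \<and> finite (UNIV - S)"

definition generates :: "nat set \<Rightarrow> nat set \<Rightarrow> bool" where
  "generates A S \<longleftrightarrow> submonoid_nat hull A = S"

definition minimal_generating_set :: "nat set \<Rightarrow> nat set \<Rightarrow> bool" where
  "minimal_generating_set A S \<longleftrightarrow> generates A S \<and> (\<forall>B. B \<subset> A \<longrightarrow> \<not> generates B S)"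

text \<open>The description is proper for numerical semigroups, and the set is then finite:
  see \<open>minimal_generating_set_unique\<close> and \<open>finite_min_gens\<close> below.\<close>

definition min_gens :: "nat set \<Rightarrow> nat set" where
  "min_gens S = (THE A. minimal_generating_set A S)"

lemma submonoid_nat_hull: "submonoid_nat (submonoid_nat hull A)"
  by (auto simp: hull_def submonoid_nat_def)

lemma zero_in_hull: "0 \<in> submonoid_nat hull A"
  by (auto simp: hull_def submonoid_nat_def)

lemma add_in_hull:
  "x \<in> submonoid_nat hull A \<Longrightarrow> y \<in> submonoid_nat hull A \<Longrightarrow> x + y \<in> submonoid_nat hull A"
  by (auto simp: hull_def submonoid_nat_def)

context
  fixes S assumes S: "numerical_semigroup S"
begin

private definition atoms :: "nat set" where
  "atoms = {x \<in> S. x \<noteq> 0 \<and> (\<forall>y\<in>S. \<forall>z\<in>S. x = y + z \<longrightarrow> y = 0 \<or> z = 0)}"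

private lemma generates_atoms: "generates atoms S"
proof -
  have sub: "submonoid_nat S" using S by (simp add: numerical_semigroup_def)
  have "submonoid_nat hull atoms \<subseteq> S"
    by (rule hull_minimal) (auto simp: atoms_def sub)
  moreover have "x \<in> submonoid_nat hull atoms" if "x \<in> S" for x
    using that
  proof (induction x rule: less_induct)
    case (less x)
    show ?case
    proof (cases "x = 0 \<or> x \<in> atoms")
      case True
      then show ?thesis
        by (auto intro: zero_in_hull hull_inc)
    next
      case False
      then obtain y z where "y \<in> S" "z \<in> S" "x = y + z" "y \<noteq> 0" "z \<noteq> 0"
        using less.prems by (auto simp: atoms_def)
      then show ?thesis
        using less.IH[of y] less.IH[of z] by (auto intro: add_in_hull)
    qed
  qed
  ultimately show ?thesis by (auto simp: generates_def)
qed

private lemma atoms_subset: "atoms \<subseteq> B" if "generates B S"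
proof
  fix x assume x: "x \<in> atoms"
  show "x \<in> B"
  proof (rule ccontr)
    assume "x \<notin> B"
    have sub: "submonoid_nat S" using S by (simp add: numerical_semigroup_def)
    have "submonoid_nat (S - {x})"
      unfolding submonoid_nat_def
    proof (intro conjI ballI)
      show "0 \<in> S - {x}" using x sub by (auto simp: atoms_def submonoid_nat_def)
      fix y z assume yz: "y \<in> S - {x}" "z \<in> S - {x}"
      then have "y + z \<noteq> x"
        using x by (cases "y = 0"; cases "z = 0") (auto simp: atoms_def)
      then show "y + z \<in> S - {x}" using yz sub by (auto simp: submonoid_nat_def)
    qed
    moreover have "B \<subseteq> S - {x}"
      using that \<open>x \<notin> B\<close> hull_subset[of B submonoid_nat] by (auto simp: generates_def)
    ultimately have "submonoid_nat hull B \<subseteq> S - {x}" by (intro hull_minimal)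
    then show False using that x by (auto simp: generates_def atoms_def)
  qed
qed

private lemma minimal_generating_set_iff: "minimal_generating_set A S \<longleftrightarrow> A = atoms"
proof
  assume "minimal_generating_set A S"
  then show "A = atoms"
    using generates_atoms atoms_subset[of A] by (auto simp: minimal_generating_set_def)
next
  assume "A = atoms"
  then show "minimal_generating_set A S"
    using generates_atoms atoms_subset by (auto simp: minimal_generating_set_def)
qed

lemma minimal_generating_set_unique: "\<exists>!A. minimal_generating_set A S"
  by (simp add: minimal_generating_set_iff)

lemma minimal_generating_set_min_gens: "minimal_generating_set (min_gens S) S"
  unfolding min_gens_def by (rule theI') (rule minimal_generating_set_unique)

lemma finite_min_gens: "finite (min_gens S)"
proof -
  have "finite (UNIV - S)" using S by (simp add: numerical_semigroup_def)
  then obtain k where "\<forall>n\<in>UNIV - S. n < k"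
    using finite_nat_set_iff_bounded by blast
  then have k: "n \<in> S" if "n \<ge> k" for n
    using that \<open>\<forall>n\<in>UNIV - S. n < k\<close> by (meson DiffI UNIV_I not_less)
  have "x \<le> 2 * k + 1" if "x \<in> atoms" for x
  proof (rule ccontr)
    assume "\<not> x \<le> 2 * k + 1"
    then have "Suc k \<in> S" "x - Suc k \<in> S" "x = Suc k + (x - Suc k)" "x - Suc k \<noteq> 0"
      by (auto intro!: k)
    moreover have "y = 0 \<or> z = 0" if "y \<in> S" "z \<in> S" "x = y + z" for y z
      using \<open>x \<in> atoms\<close> that by (simp add: atoms_def)
    ultimately show False by (metis nat.distinct(1))
  qed
  then have "finite atoms" by (meson finite_nat_set_iff_bounded_le)
  then show ?thesis using minimal_generating_set_min_gens minimal_generating_set_iff by simp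
qed

end

text \<open>A tuple in \<open>\<nat>\<^sup>e\<close> is a function on the minimal generators, extended by zero: the
  generator \<open>n\<close> is the index of its own coefficient \<open>a n\<close>.\<close>

definition factorizations :: "nat \<Rightarrow> nat set \<Rightarrow> (nat \<Rightarrow> nat) set" where
  "factorizations r S =
     {a. (\<forall>n. n \<notin> min_gens S \<longrightarrow> a n = 0) \<and> (\<Sum>n\<in>min_gens S. a n * n) = r}"

definition fact_length :: "nat set \<Rightarrow> (nat \<Rightarrow> nat) \<Rightarrow> nat" where
  "fact_length S a = (\<Sum>n\<in>min_gens S. a n)"

definition dot_product :: "nat set \<Rightarrow> (nat \<Rightarrow> nat) \<Rightarrow> (nat \<Rightarrow> nat) \<Rightarrow> nat" where
  "dot_product S a b = (\<Sum>n\<in>min_gens S. a n * b n)"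

definition length_set :: "nat \<Rightarrow> nat set \<Rightarrow> nat set" where
  "length_set r S = fact_length S ` factorizations r S"

definition ULF :: "nat set \<Rightarrow> nat set" where
  "ULF S = {r \<in> S. \<exists>!l. l \<in> length_set r S}"

text \<open>An undirected graph is a digraph with a symmetric arc relation.\<close>

definition nabla :: "nat \<Rightarrow> nat set \<Rightarrow> (nat \<Rightarrow> nat) pair_pre_digraph" where
  "nabla r S =
     \<lparr> pverts = factorizations r S,
       parcs = {(a, b). a \<in> factorizations r S \<and> b \<in> factorizations r S \<and>
                        a \<noteq> b \<and> dot_product S a b \<noteq> 0} \<rparr>"

definition Betti :: "nat set \<Rightarrow> nat set" where
  "Betti S = {r \<in> S. \<not> connected (with_proj (nabla r S))}"

definition BBetti :: "nat set \<Rightarrow> nat set" where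
  "BBetti S = Betti S \<inter> ULF S"

definition UBetti :: "nat set \<Rightarrow> nat set" where
  "UBetti S = Betti S - BBetti S"

text \<open>Here \<open>X + S\<close> is the Minkowski sum.\<close>

definition Ap :: "nat set \<Rightarrow> nat set \<Rightarrow> nat set" where
  "Ap S X = S - (X + S)"

end

theory Submission
  imports Defs
begin

text \<open>
  Adding a fixed factorization of \<open>s\<close> preserves differences of lengths, so no element of
  \<open>ULF S\<close> lies in \<open>UBetti S + S\<close>. Conversely, let \<open>r\<close> have two factorizations of different
  lengths. If \<open>\<nabla>\<^sub>r\<close> is disconnected, then \<open>r\<close> itself lies in \<open>UBetti S\<close>. Otherwise a path
  between the two contains an edge along which the length changes; its endpoints share a
  generator \<open>n\<close>, and cancelling \<open>n\<close> gives two factorizations of \<open>r - n\<close> of different lengths,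
  so one concludes by induction on \<open>r\<close>.
\<close>

text \<open>A function that agrees at both ends of every arc is constant along walks. Connectedness
  concerns the symmetric closure, whose steps may reverse an arc, which is harmless because equality
  is symmetric.\<close>

lemma connected_obtains_arc_differing:
  assumes "connected G" "u \<in> verts G" "v \<in> verts G" "f u \<noteq> f v"
  obtains e where "e \<in> arcs G" "f (tail G e) \<noteq> f (head G e)"
proof -
  have "(u, v) \<in> rtrancl_on (verts G) (parcs (mk_symmetric G))"
    using assms(1-3) by (simp add: connected_def strongly_connected_def reachable_def)
  then have "f u = f v" if "\<And>e. e \<in> arcs G \<Longrightarrow> f (tail G e) = f (head G e)"
  proof induction
    case (step y z)
    then show ?case using that by (auto simp: parcs_mk_symmetric)
  qed simp
  with assms(4) that show ?thesis by metis
qed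

context
  fixes S assumes S: "numerical_semigroup S"
begin

lemma zero_in_semigroup: "0 \<in> S"
  using S by (simp add: numerical_semigroup_def submonoid_nat_def)

lemma add_in_semigroup: "x \<in> S \<Longrightarrow> y \<in> S \<Longrightarrow> x + y \<in> S"
  using S by (simp add: numerical_semigroup_def submonoid_nat_def)

lemma hull_min_gens: "submonoid_nat hull min_gens S = S"
  using minimal_generating_set_min_gens[OF S]
  by (simp add: minimal_generating_set_def generates_def)

lemma min_gens_subset: "min_gens S \<subseteq> S"
  using hull_subset[of "min_gens S" submonoid_nat] by (simp add: hull_min_gens)

text \<open>Every submonoid contains 0, so dropping 0 from a generating set leaves its hull
  unchanged, against minimality. This makes cancelling a generator a strict descent.\<close>

lemma zero_notin_min_gens: "0 \<notin> min_gens S"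
proof
  assume 0: "0 \<in> min_gens S"
  have "submonoid_nat hull (min_gens S - {0}) = S"
  proof
    show "submonoid_nat hull (min_gens S - {0}) \<subseteq> S"
      using hull_mono[of "min_gens S - {0}" "min_gens S" submonoid_nat]
      by (auto simp: hull_min_gens)
    have "min_gens S \<subseteq> submonoid_nat hull (min_gens S - {0})"
      using zero_in_hull by (auto intro: hull_inc)
    then have "submonoid_nat hull min_gens S \<subseteq> submonoid_nat hull (min_gens S - {0})"
      by (rule hull_minimal) (rule submonoid_nat_hull)
    then show "S \<subseteq> submonoid_nat hull (min_gens S - {0})"
      by (simp add: hull_min_gens)
  qed
  moreover have "min_gens S - {0} \<subset> min_gens S" using 0 by auto
  ultimately show False
    using minimal_generating_set_min_gens[OF S]
    by (auto simp: minimal_generating_set_def generates_def)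
qed

lemma factorizations_add:
  "a \<in> factorizations r S \<Longrightarrow> b \<in> factorizations s S \<Longrightarrow>
    (\<lambda>n. a n + b n) \<in> factorizations (r + s) S"
  by (auto simp: factorizations_def algebra_simps sum.distrib)

lemma fact_length_add:
  "fact_length S (\<lambda>n. a n + b n) = fact_length S a + fact_length S b"
  by (simp add: fact_length_def sum.distrib)

lemma factorization_single:
  "n \<in> min_gens S \<Longrightarrow> (\<lambda>m. if m = n then 1 else 0) \<in> factorizations n S"
  \<comment> \<open>A sum over an infinite set would be 0 by default, so finiteness is what yields
    the value \<open>n\<close>.\<close>
  using finite_min_gens[OF S]
  by (auto simp: factorizations_def if_distrib[of "\<lambda>x. x * m" for m] cong: if_cong)

text \<open>The numbers with a factorization form a submonoid containing the generators, hence
  contain their hull.\<close>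

lemma factorizations_nonempty:
  assumes "r \<in> S"
  shows "factorizations r S \<noteq> {}"
proof -
  have "submonoid_nat {r. factorizations r S \<noteq> {}}"
    unfolding submonoid_nat_def
  proof (intro conjI ballI)
    show "0 \<in> {r. factorizations r S \<noteq> {}}"
      by (auto simp: factorizations_def intro!: exI[of _ "\<lambda>_. 0"])
  qed (use factorizations_add in blast)
  moreover have "min_gens S \<subseteq> {r. factorizations r S \<noteq> {}}"
    using factorization_single by blast
  ultimately have "submonoid_nat hull min_gens S \<subseteq> {r. factorizations r S \<noteq> {}}"
    by (intro hull_minimal)
  with assms show ?thesis by (auto simp: hull_min_gens)
qed

lemma factorization_in_semigroup:
  assumes "a \<in> factorizations r S"
  shows "r \<in> S"
proof -
  have multiple: "k * n \<in> S" if "n \<in> S" for k n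
    by (induction k) (auto intro: zero_in_semigroup add_in_semigroup that)
  have "(\<Sum>n\<in>A. a n * n) \<in> S" if "finite A" "A \<subseteq> S" for A
    using that by induction (auto intro: zero_in_semigroup add_in_semigroup multiple)
  then show ?thesis
    using assms finite_min_gens[OF S] min_gens_subset by (auto simp: factorizations_def)
qed

text \<open>Both subtractions are truncated: \<open>a n \<noteq> 0\<close> makes the first exact,
  and the third conclusion records that \<open>r - n\<close> is exact too.\<close>

lemma factorization_cancel:
  assumes a: "a \<in> factorizations r S" and n: "n \<in> min_gens S" "a n \<noteq> 0"
  shows "a(n := a n - 1) \<in> factorizations (r - n) S" (is "?a \<in> _")
    and "fact_length S a = Suc (fact_length S (a(n := a n - 1)))"
    and "n \<le> r"
proof -
  have fin: "finite (min_gens S)" by (rule finite_min_gens[OF S])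
  obtain k where k: "a n = Suc k" using n(2) by (cases "a n") auto
  have "(\<Sum>m\<in>min_gens S. a m * m) = n + (\<Sum>m\<in>min_gens S. ?a m * m)"
    by (simp add: sum.remove[OF fin n(1)] k cong: sum.cong_simp)
  moreover have "(\<Sum>m\<in>min_gens S. a m) = Suc (\<Sum>m\<in>min_gens S. ?a m)"
    by (simp add: sum.remove[OF fin n(1)] k cong: sum.cong_simp)
  ultimately show "?a \<in> factorizations (r - n) S"
    "fact_length S a = Suc (fact_length S ?a)" "n \<le> r"
    using a n(1) by (auto simp: factorizations_def fact_length_def)
qed

text \<open>Since some factorization exists, uniqueness of the length amounts to pairwise
  equality.\<close>

lemma ULF_iff:
  "r \<in> ULF S \<longleftrightarrow>
    r \<in> S \<and> (\<forall>a\<in>factorizations r S. \<forall>b\<in>factorizations r S. fact_length S a = fact_length S b)"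
proof (cases "r \<in> S")
  case True
  then obtain c where "c \<in> factorizations r S" using factorizations_nonempty by blast
  then have "(\<exists>!l. l \<in> length_set r S) \<longleftrightarrow>
      (\<forall>a\<in>factorizations r S. \<forall>b\<in>factorizations r S. fact_length S a = fact_length S b)"
    unfolding length_set_def by blast
  with True show ?thesis by (simp add: ULF_def)
qed (simp add: ULF_def)

lemma Betti_diff_ULF: "UBetti S = Betti S - ULF S"
  by (auto simp: UBetti_def BBetti_def)

lemma ULF_summand:
  assumes "b + s \<in> ULF S" "b \<in> S" "s \<in> S"
  shows "b \<in> ULF S"
proof -
  obtain c where c: "c \<in> factorizations s S"
    using factorizations_nonempty[OF assms(3)] by blast
  have "fact_length S x = fact_length S y"
    if "x \<in> factorizations b S" "y \<in> factorizations b S" for x y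
  proof -
    have "fact_length S (\<lambda>n. x n + c n) = fact_length S (\<lambda>n. y n + c n)"
      using assms(1) factorizations_add[OF that(1) c] factorizations_add[OF that(2) c]
      unfolding ULF_iff by blast
    then show ?thesis by (simp add: fact_length_add)
  qed
  with assms(2) show ?thesis unfolding ULF_iff by blast
qed

lemma not_ULF_imp_in_UBetti_plus:
  assumes "r \<in> S" "r \<notin> ULF S"
  shows "r \<in> UBetti S + S"
  using assms
proof (induction r rule: less_induct)
  case (less r)
  show ?case
  proof (cases "r \<in> Betti S")
    case True
    with less.prems have "r + 0 \<in> UBetti S + S"
      by (intro set_plus_intro) (auto simp: Betti_diff_ULF zero_in_semigroup)
    then show ?thesis by simp
  next
    case False
    with less.prems have "connected (with_proj (nabla r S))" by (simp add: Betti_def)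
    moreover obtain u v where "u \<in> factorizations r S" "v \<in> factorizations r S"
      "fact_length S u \<noteq> fact_length S v"
      using less.prems by (auto simp: ULF_iff)
    ultimately obtain e where "e \<in> arcs (with_proj (nabla r S))"
      "fact_length S (tail (nabla r S) e) \<noteq> fact_length S (head (nabla r S) e)"
      using connected_obtains_arc_differing[of "with_proj (nabla r S)" u v "fact_length S"]
      by (auto simp: nabla_def)
    then obtain a b where ab: "a \<in> factorizations r S" "b \<in> factorizations r S"
      "dot_product S a b \<noteq> 0" "fact_length S a \<noteq> fact_length S b"
      by (auto simp: nabla_def)
    \<comment> \<open>A nonzero dot product has a nonzero term, which gives a generator in both
      supports.\<close>
    from ab(3) obtain n where n: "n \<in> min_gens S" "a n \<noteq> 0" "b n \<noteq> 0"
      using finite_min_gens[OF S] by (auto simp: dot_product_def)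
    note a' = factorization_cancel[OF ab(1) n(1,2)]
    note b' = factorization_cancel[OF ab(2) n(1,3)]
    \<comment> \<open>Both lengths drop by exactly one, so they still differ.\<close>
    have "r - n \<notin> ULF S" using a'(1,2) b'(1,2) ab(4) by (auto simp: ULF_iff)
    moreover have "r - n < r" using a'(3) n(1) zero_notin_min_gens by (cases "n = 0") auto
    ultimately have "r - n \<in> UBetti S + S"
      using less.IH factorization_in_semigroup[OF a'(1)] by blast
    then obtain x s where xs: "x \<in> UBetti S" "s \<in> S" "r - n = x + s"
      by (auto elim: set_plus_elim)
    \<comment> \<open>The cancelled generator is returned to the semigroup summand, so the Betti
      element \<open>x\<close> found for \<open>r - n\<close> also serves \<open>r\<close>.\<close>
    have "s + n \<in> S" using xs(2) n(1) min_gens_subset add_in_semigroup by blast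
    with xs(1) have "x + (s + n) \<in> UBetti S + S" by (rule set_plus_intro)
    also have "x + (s + n) = r" using xs(3) a'(3) by simp
    finally show ?thesis .
  qed
qed

end

theorem theorem4p1:
  fixes S :: "nat set"
  assumes "numerical_semigroup S"
  shows "ULF S = Ap S (UBetti S)"
proof
  have "b + s \<notin> ULF S" if "b \<in> UBetti S" "s \<in> S" for b s
    using that ULF_summand[OF assms, of b s] by (auto simp: Betti_diff_ULF[OF assms] Betti_def)
  then show "ULF S \<subseteq> Ap S (UBetti S)"
    by (auto simp: Ap_def elim!: set_plus_elim) (simp add: ULF_def)
  show "Ap S (UBetti S) \<subseteq> ULF S"
    using not_ULF_imp_in_UBetti_plus[OF assms] by (auto simp: Ap_def)
qed

end
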